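(* Let $R$ be a unital ring with involution $*$, let $a\in R$ be core invertible, and let $n\geq 1$ be an integer. Then (the inverses below exist and): (i) $a^{\mathrm{core}}=a^\#p_a$; (ii) $(a^{\mathrm{core}})^2a=a^\#$; (iii) $(a^{\mathrm{core}})^n=(a^n)^{\mathrm{core}}$; (iv) $((a^{\mathrm{core}})^{\mathrm{core}})^{\mathrm{core}}=a^{\mathrm{core}}$; (v) if moreover $a$ is Moore-Penrose invertible, then $$a^\#=a^{\mathrm{core}}aa_{\mathrm{core}},\quad a^\dagger=a_{\mathrm{core}}aa^{\mathrm{core}},\quad a^{\mathrm{core}}=a^\#aa^\dagger,\quad a_{\mathrm{core}}=a^\dagger aa^\#.$$
   Context: For $a\in R$: $aR=\{ax:x\in R\}$, $Ra=\{xa:x\in R\}$. Inverses (each unique when it exists): the group inverse $a^\#$ is the $x$ with $axa=a$, $xax=x$, $ax=xa$; the Moore-Penrose inverse $a^\dagger$ is the $x$ with $axa=a$, $xax=x$, $(ax)^*=ax$, $(xa)^*=xa$; the core inverse $a^{\mathrm{core}}$ is the $x$ with $axa=a$, $xR=aR$, $Rx=Ra^*$; the dual core inverse $a_{\mathrm{core}}$ is the $x$ with $axa=a$, $xR=a^*R$, $Rx=Ra$. The element $p_a$ is the unique self-adjoint idempotent with $p_aR=aR$ (it exists if $a$ is core invertible). A core invertible element is group invertible; an element that is both group and Moore-Penrose invertible is both core and dual core invertible. *)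

theory Defs
  imports Main
begin

text \<open>
  Associative unital rings with an involution. The class is built on \<open>ring + monoid_mult\<close> rather
  than on \<open>ring_1\<close>, because the latter additionally demands \<open>0 \<noteq> 1\<close>.
\<close>

class involution_ring = ring + monoid_mult +
  fixes star :: "'a \<Rightarrow> 'a"
  assumes star_star: "star (star a) = a"
    and star_add: "star (a + b) = star a + star b"
    and star_mult: "star (a * b) = star b * star a"

definition right_ideal :: "'a::involution_ring \<Rightarrow> 'a set"
  where "right_ideal a = {a * x |x. True}"

definition left_ideal :: "'a::involution_ring \<Rightarrow> 'a set"
  where "left_ideal a = {x * a |x. True}"

definition is_group_inverse :: "'a::involution_ring \<Rightarrow> 'a \<Rightarrow> bool"
  where "is_group_inverse a x \<longleftrightarrow> a * x * a = a \<and> x * a * x = x \<and> a * x = x * a"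

definition is_mp_inverse :: "'a::involution_ring \<Rightarrow> 'a \<Rightarrow> bool"
  where "is_mp_inverse a x \<longleftrightarrow>
    a * x * a = a \<and> x * a * x = x \<and> star (a * x) = a * x \<and> star (x * a) = x * a"

definition is_core_inverse :: "'a::involution_ring \<Rightarrow> 'a \<Rightarrow> bool"
  where "is_core_inverse a x \<longleftrightarrow>
    a * x * a = a \<and> right_ideal x = right_ideal a \<and> left_ideal x = left_ideal (star a)"

definition is_dual_core_inverse :: "'a::involution_ring \<Rightarrow> 'a \<Rightarrow> bool"
  where "is_dual_core_inverse a x \<longleftrightarrow>
    a * x * a = a \<and> right_ideal x = right_ideal (star a) \<and> left_ideal x = left_ideal a"

definition is_range_projection :: "'a::involution_ring \<Rightarrow> 'a \<Rightarrow> bool"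
  where "is_range_projection a p \<longleftrightarrow>
    p * p = p \<and> star p = p \<and> right_ideal p = right_ideal a"

definition group_invertible :: "'a::involution_ring \<Rightarrow> bool"
  where "group_invertible a \<longleftrightarrow> (\<exists>x. is_group_inverse a x)"

definition mp_invertible :: "'a::involution_ring \<Rightarrow> bool"
  where "mp_invertible a \<longleftrightarrow> (\<exists>x. is_mp_inverse a x)"

definition core_invertible :: "'a::involution_ring \<Rightarrow> bool"
  where "core_invertible a \<longleftrightarrow> (\<exists>x. is_core_inverse a x)"

definition dual_core_invertible :: "'a::involution_ring \<Rightarrow> bool"
  where "dual_core_invertible a \<longleftrightarrow> (\<exists>x. is_dual_core_inverse a x)"

text \<open>
  The following are meaningful only when the respective object exists; it is then unique, as the
  lemmas at the end show.
\<close>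

definition group_inverse :: "'a::involution_ring \<Rightarrow> 'a"
  where "group_inverse a = (THE x. is_group_inverse a x)"

definition mp_inverse :: "'a::involution_ring \<Rightarrow> 'a"
  where "mp_inverse a = (THE x. is_mp_inverse a x)"

definition core_inverse :: "'a::involution_ring \<Rightarrow> 'a"
  where "core_inverse a = (THE x. is_core_inverse a x)"

definition dual_core_inverse :: "'a::involution_ring \<Rightarrow> 'a"
  where "dual_core_inverse a = (THE x. is_dual_core_inverse a x)"

definition range_projection :: "'a::involution_ring \<Rightarrow> 'a"
  where "range_projection a = (THE p. is_range_projection a p)"

lemma right_ideal_eqD:
  assumes "right_ideal x = right_ideal a"
  obtains u v where "x = a * u" "a = x * v"
proof -
  have "x \<in> right_ideal x" "a \<in> right_ideal a"
    unfolding right_ideal_def by (metis (mono_tags, lifting) mem_Collect_eq mult.right_neutral)+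
  then have "x \<in> right_ideal a" "a \<in> right_ideal x" using assms by simp_all
  then show thesis using that unfolding right_ideal_def by blast
qed

lemma left_ideal_eqD:
  assumes "left_ideal x = left_ideal a"
  obtains u v where "x = u * a" "a = v * x"
proof -
  have "x \<in> left_ideal x" "a \<in> left_ideal a"
    unfolding left_ideal_def by (metis (mono_tags, lifting) mem_Collect_eq mult.left_neutral)+
  then have "x \<in> left_ideal a" "a \<in> left_ideal x" using assms by simp_all
  then show thesis using that unfolding left_ideal_def by blast
qed

lemma is_group_inverse_unique:
  assumes x: "is_group_inverse a x" and y: "is_group_inverse a y"
  shows "x = y"
proof -
  have "a * x = a * y * (a * x)"
    using y unfolding is_group_inverse_def by (metis mult.assoc)
  also have "\<dots> = y * (a * x * a)"
    using x y unfolding is_group_inverse_def by (metis mult.assoc)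
  also have "\<dots> = a * y"
    using x y unfolding is_group_inverse_def by metis
  finally have "a * x = a * y" .
  then show ?thesis
    using x y unfolding is_group_inverse_def by (metis mult.assoc)
qed

lemma is_mp_inverse_unique:
  assumes x: "is_mp_inverse a x" and y: "is_mp_inverse a y"
  shows "x = y"
proof -
  have "a * x = star (a * y * (a * x))"
    using x y unfolding is_mp_inverse_def by (metis mult.assoc)
  also have "\<dots> = a * x * (a * y)"
    using x y unfolding is_mp_inverse_def by (simp only: star_mult[of "a * y"])
  also have "\<dots> = a * y"
    using x unfolding is_mp_inverse_def by (metis mult.assoc)
  finally have r: "a * x = a * y" .
  have "x * a = star (x * a * (y * a))"
    using x y unfolding is_mp_inverse_def by (metis mult.assoc)
  also have "\<dots> = y * a * (x * a)"
    using x y unfolding is_mp_inverse_def by (simp only: star_mult[of "x * a"])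
  also have "\<dots> = y * a"
    using x unfolding is_mp_inverse_def by (metis mult.assoc)
  finally have "x * a = y * a" .
  with r show ?thesis
    using x y unfolding is_mp_inverse_def by (metis mult.assoc)
qed

lemma is_core_inverse_equations:
  assumes "is_core_inverse a x"
  shows "a * x * a = a" "x * a * x = x" "star (a * x) = a * x" "x * a * a = a" "a * x * x = x"
proof -
  from assms have axa: "a * x * a = a" and r: "right_ideal x = right_ideal a"
    and l: "left_ideal x = left_ideal (star a)"
    unfolding is_core_inverse_def by auto
  obtain u v where u: "x = a * u" and v: "a = x * v" using right_ideal_eqD[OF r] .
  obtain w w' where w: "x = w * star a" using left_ideal_eqD[OF l] .
  have "star a = star a * star (a * x)"
    by (subst axa[symmetric]) (simp only: star_mult)
  then have x: "x = x * star (a * x)"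
    using w by (metis mult.assoc)
  then have "a * x = a * x * star (a * x)"
    by (metis mult.assoc)
  then show sa: "star (a * x) = a * x"
    by (metis star_mult star_star)
  show "a * x * a = a" by (fact axa)
  show xax: "x * a * x = x"
    using x sa by (metis mult.assoc)
  show "x * a * a = a"
    using xax v by (metis mult.assoc)
  show "a * x * x = x"
    using axa u by (metis mult.assoc)
qed

lemma is_core_inverse_unique:
  assumes x: "is_core_inverse a x" and y: "is_core_inverse a y"
  shows "x = y"
proof -
  note X = is_core_inverse_equations[OF x] and Y = is_core_inverse_equations[OF y]
  have "a * x = star (a * y * (a * x))"
    using X Y by (metis mult.assoc)
  also have "\<dots> = a * x * (a * y)"
    using X Y by (simp only: star_mult[of "a * y"])
  also have "\<dots> = a * y"
    using X by (metis mult.assoc)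
  finally have e: "a * x = a * y" .
  have "x = x * (a * y)"
    using X e by (metis mult.assoc)
  also have "\<dots> = x * a * a * y * y"
    using Y(5) by (metis mult.assoc)
  also have "\<dots> = y"
    using X(4) Y(5) by simp
  finally show ?thesis .
qed

lemma right_ideal_star: "right_ideal (star a) = star ` left_ideal a"
  unfolding right_ideal_def left_ideal_def
  by (auto simp: image_iff star_mult) (metis star_mult star_star)+

lemma left_ideal_star: "left_ideal (star a) = star ` right_ideal a"
  unfolding right_ideal_def left_ideal_def
  by (auto simp: image_iff star_mult) (metis star_mult star_star)+

lemma is_dual_core_inverse_star:
  assumes "is_dual_core_inverse a x"
  shows "is_core_inverse (star a) (star x)"
  using assms unfolding is_dual_core_inverse_def is_core_inverse_def
  by (metis left_ideal_star mult.assoc right_ideal_star star_mult)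

lemma is_dual_core_inverse_unique:
  assumes "is_dual_core_inverse a x" and "is_dual_core_inverse a y"
  shows "x = y"
  using is_core_inverse_unique[OF assms[THEN is_dual_core_inverse_star]]
  by (metis star_star)

lemma is_range_projection_unique:
  assumes p: "is_range_projection a p" and q: "is_range_projection a q"
  shows "p = q"
proof -
  have "right_ideal p = right_ideal q"
    using p q unfolding is_range_projection_def by simp
  then obtain u v where "p = q * u" "q = p * v" by (rule right_ideal_eqD)
  then have "q * p = p" "p * q = q"
    using p q unfolding is_range_projection_def by (metis mult.assoc)+
  then show ?thesis
    using p q unfolding is_range_projection_def by (metis star_mult)
qed

end

theory Submission imports Defs begin

text \<open>
  An element \<open>x\<close> is the core inverse of \<open>a\<close> exactly when \<open>a x a = a\<close>, \<open>x a x = x\<close>,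
  \<open>(a x)\<^sup>* = a x\<close>, \<open>x a\<^sup>2 = a\<close> and \<open>a x\<^sup>2 = x\<close>. With this equational description the
  group inverse is \<open>x\<^sup>2 a\<close>, the range projection is \<open>a x\<close>, the core inverse of \<open>a\<^sup>n\<close> is
  \<open>x\<^sup>n\<close> because \<open>a\<^sup>n x\<^sup>n = a x\<close> and \<open>x\<^sup>n a\<^sup>n = x a\<close>, and \<open>x\<close> and \<open>a\<^sup>2 x\<close> are core
  inverses of each other. If \<open>m\<close> is the Moore-Penrose inverse, then \<open>a m = a x\<close> by uniqueness
  of the range projection.
\<close>

lemma right_ideal_eqI: "x = a * u \<Longrightarrow> a = x * v \<Longrightarrow> right_ideal x = right_ideal a"
  unfolding right_ideal_def by (auto, metis mult.assoc, metis mult.assoc)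

lemma left_ideal_eqI: "x = u * a \<Longrightarrow> a = v * x \<Longrightarrow> left_ideal x = left_ideal a"
  unfolding left_ideal_def by (auto, metis mult.assoc, metis mult.assoc)

text \<open>Converse of \<open>is_core_inverse_equations\<close>: later candidates are checked by
  equations alone, without handling ideals.\<close>

lemma is_core_inverseI:
  assumes "a * x * a = a" "x * a * x = x" "star (a * x) = a * x" "x * a * a = a" "a * x * x = x"
  shows "is_core_inverse a x"
proof -
  have "right_ideal x = right_ideal a"
    by (rule right_ideal_eqI[where u = "x * x" and v = "a * a"])
      (simp_all add: assms flip: mult.assoc)
  moreover have "left_ideal x = left_ideal (star a)"
  proof (rule left_ideal_eqI)
    \<comment> \<open>Self-adjointness of \<open>a * x\<close> turns \<open>x = x * (a * x)\<close>
      into this factorization, and taking \<open>star\<close> of \<open>a * x * a = a\<close> gives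
      the next one.\<close>
    show "x = x * star x * star a"
      using assms by (metis mult.assoc star_mult)
    show "star a = star a * a * x"
      using assms by (metis mult.assoc star_mult)
  qed
  ultimately show ?thesis
    using assms(1) unfolding is_core_inverse_def by simp
qed

lemma group_inverse_eqI: "is_group_inverse a x \<Longrightarrow> group_inverse a = x"
  unfolding group_inverse_def by (blast intro: is_group_inverse_unique the_equality)

lemma mp_inverse_eqI: "is_mp_inverse a x \<Longrightarrow> mp_inverse a = x"
  unfolding mp_inverse_def by (blast intro: is_mp_inverse_unique the_equality)

lemma core_inverse_eqI: "is_core_inverse a x \<Longrightarrow> core_inverse a = x"
  unfolding core_inverse_def by (blast intro: is_core_inverse_unique the_equality)

lemma dual_core_inverse_eqI: "is_dual_core_inverse a x \<Longrightarrow> dual_core_inverse a = x"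
  unfolding dual_core_inverse_def by (blast intro: is_dual_core_inverse_unique the_equality)

lemma range_projection_eqI: "is_range_projection a p \<Longrightarrow> range_projection a = p"
  unfolding range_projection_def by (blast intro: is_range_projection_unique the_equality)

lemma is_range_projectionI:
  assumes "a * x * a = a" "star (a * x) = a * x"
  shows "is_range_projection a (a * x)"
proof -
  have "right_ideal (a * x) = right_ideal a"
    by (rule right_ideal_eqI[where u = x and v = a]) (simp_all add: assms)
  then show ?thesis
    using assms unfolding is_range_projection_def by (simp flip: mult.assoc)
qed

text \<open>Both products of \<open>a\<close> with \<open>x * x * a\<close> are
  \<open>x * a\<close>: one by \<open>a * x * x = x\<close>, the other by
  \<open>x * a * a = a\<close>.\<close>

lemma is_group_inverse_core:
  assumes "is_core_inverse a x"
  shows "is_group_inverse a (x * x * a)"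
  using is_core_inverse_equations[OF assms] unfolding is_group_inverse_def
  by (metis mult.assoc)

text \<open>Exponents start at \<open>Suc 0\<close> because at exponent 0 both products are 1, which
  need not equal \<open>a * x\<close> or \<open>x * a\<close>.\<close>

lemma core_inverse_power_collapse:
  assumes "is_core_inverse a x"
  shows "a ^ Suc n * x ^ Suc n = a * x" "x ^ Suc n * a ^ Suc n = x * a"
proof -
  note X = is_core_inverse_equations[OF assms]
  show "a ^ Suc n * x ^ Suc n = a * x"
  proof (induction n)
    case (Suc n)
    have "a ^ Suc (Suc n) * x ^ Suc (Suc n) = a * (a ^ Suc n * x ^ Suc n) * x"
      by (simp only: power_Suc[of a "Suc n"] power_Suc2[of x "Suc n"] mult.assoc)
    also have "\<dots> = a * x"
      using Suc X(5) by (metis mult.assoc)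
    finally show ?case .
  qed simp
  show "x ^ Suc n * a ^ Suc n = x * a"
  proof (induction n)
    case (Suc n)
    have "x ^ Suc (Suc n) * a ^ Suc (Suc n) = x * (x ^ Suc n * a ^ Suc n) * a"
      by (simp only: power_Suc[of x "Suc n"] power_Suc2[of a "Suc n"] mult.assoc)
    also have "\<dots> = x * a"
      using Suc X(4) by (metis mult.assoc)
    finally show ?case .
  qed simp
qed

lemma is_core_inverse_power:
  assumes "is_core_inverse a x" "n \<ge> 1"
  shows "is_core_inverse (a ^ n) (x ^ n)"
proof -
  note X = is_core_inverse_equations[OF assms(1)]
  obtain k where n: "n = Suc k"
    using assms(2) by (cases n) auto
  note C = core_inverse_power_collapse[OF assms(1), of k, folded n]
  \<comment> \<open>Left multiplication by \<open>a * x\<close> or \<open>x * a\<close> fixes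
    \<open>a\<close> and \<open>x\<close>, hence their positive powers, by acting on the first
    factor.\<close>
  have "a * x * a ^ n = a ^ n" "x * a * a ^ n = a ^ n"
    "a * x * x ^ n = x ^ n" "x * a * x ^ n = x ^ n"
    unfolding n power_Suc using X by (simp_all flip: mult.assoc)
  then show ?thesis
    by (intro is_core_inverseI) (simp_all add: C X)
qed

text \<open>The products of \<open>x\<close> and \<open>a * a * x\<close> in either order equal
  \<open>a * x\<close>, a self-adjoint idempotent fixing both elements from the left.\<close>

lemma is_core_inverse_core_inverse:
  assumes "is_core_inverse a x"
  shows "is_core_inverse x (a * a * x)"
  using is_core_inverse_equations[OF assms]
  by (intro is_core_inverseI) (metis mult.assoc)+

text \<open>The same argument with the roles exchanged. Thus the third core inverse returns to
  \<open>x\<close>, although \<open>a * a * x\<close> need not be \<open>a\<close>.\<close>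

lemma is_core_inverse_square_mult:
  assumes "is_core_inverse a x"
  shows "is_core_inverse (a * a * x) x"
  using is_core_inverse_equations[OF assms]
  by (intro is_core_inverseI) (metis mult.assoc)+

text \<open>Supplies existence of the dual core inverse together with its formula; the other
  formulas of (v) are then computed from it.\<close>

lemma is_dual_core_inverse_mp_group:
  assumes g: "is_group_inverse a g" and m: "is_mp_inverse a m"
  shows "is_dual_core_inverse a (m * a * g)"
proof -
  have G: "a * g * a = a" "g * a * g = g" "a * g = g * a"
    using g unfolding is_group_inverse_def by auto
  have M: "a * m * a = a" "m * a * m = m" "star (m * a) = m * a"
    using m unfolding is_mp_inverse_def by auto
  have "a * (m * a * g) * a = a"
    using G M by (metis mult.assoc)
  moreover have "right_ideal (m * a * g) = right_ideal (star a)"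
  proof (rule right_ideal_eqI)
    show "m * a * g = star a * (star m * g)"
      using M(3) by (metis mult.assoc star_mult)
    \<comment> \<open>This is \<open>star\<close> applied to \<open>a * (m * a) = a\<close>, with
      \<open>m * a\<close> self-adjoint.\<close>
    have "star a = m * a * star a"
      using M by (metis mult.assoc star_mult)
    then show "star a = m * a * g * (a * star a)"
      using G(1) by (metis mult.assoc)
  qed
  moreover have "left_ideal (m * a * g) = left_ideal a"
  proof (rule left_ideal_eqI)
    show "m * a * g = m * g * a"
      using G(3) by (metis mult.assoc)
    show "a = a * a * (m * a * g)"
      using G M by (metis mult.assoc)
  qed
  ultimately show ?thesis
    unfolding is_dual_core_inverse_def by simp
qed

theorem theorem2p19:
  fixes a :: "'a::involution_ring" and n :: nat
  assumes "core_invertible a" and "n \<ge> 1"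
  shows
    "(group_invertible a \<and> (\<exists>p. is_range_projection a p) \<and>
        core_inverse a = group_inverse a * range_projection a) \<and>
     (core_inverse a)\<^sup>2 * a = group_inverse a \<and>
     (core_invertible (a ^ n) \<and> (core_inverse a) ^ n = core_inverse (a ^ n)) \<and>
     (core_invertible (core_inverse a) \<and> core_invertible (core_inverse (core_inverse a)) \<and>
        core_inverse (core_inverse (core_inverse a)) = core_inverse a) \<and>
     (mp_invertible a \<longrightarrow>
        dual_core_invertible a \<and>
        group_inverse a = core_inverse a * a * dual_core_inverse a \<and>
        mp_inverse a = dual_core_inverse a * a * core_inverse a \<and>
        core_inverse a = group_inverse a * a * mp_inverse a \<and>
        dual_core_inverse a = mp_inverse a * a * group_inverse a)"
proof -
  obtain x where x: "is_core_inverse a x"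
    using assms(1) unfolding core_invertible_def by blast
  note X = is_core_inverse_equations[OF x]
  define g where "g = x * x * a"
  have g: "is_group_inverse a g"
    unfolding g_def by (rule is_group_inverse_core[OF x])
  have p: "is_range_projection a (a * x)"
    using X by (intro is_range_projectionI)
  have gp: "g * (a * x) = x"
    unfolding g_def using X by (metis mult.assoc)
  note pw = is_core_inverse_power[OF x assms(2)]
  note y = is_core_inverse_core_inverse[OF x]
  note z = is_core_inverse_square_mult[OF x]
  note eqs = core_inverse_eqI[OF x] group_inverse_eqI[OF g] range_projection_eqI[OF p]
    core_inverse_eqI[OF pw] core_inverse_eqI[OF y] core_inverse_eqI[OF z]
  have mp: "dual_core_invertible a \<and>
      g = x * a * dual_core_inverse a \<and>
      mp_inverse a = dual_core_inverse a * a * x \<and>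
      x = g * a * mp_inverse a \<and>
      dual_core_inverse a = mp_inverse a * a * g"
    if inv: "mp_invertible a"
  proof -
    obtain m where m: "is_mp_inverse a m"
      using inv unfolding mp_invertible_def by blast
    then have M: "a * m * a = a" "m * a * m = m" "star (a * m) = a * m"
      unfolding is_mp_inverse_def by auto
    have am: "a * m = a * x"
      using is_range_projectionI[OF M(1,3)] p by (rule is_range_projection_unique)
    have G: "a * g * a = a"
      using g unfolding is_group_inverse_def by blast
    note d = is_dual_core_inverse_mp_group[OF g m]
    \<comment> \<open>The factor \<open>a * m * a\<close> contracts to \<open>a\<close>, and
      \<open>x * a * g = g\<close> since \<open>g\<close> begins with \<open>x\<close>.\<close>
    have "g = x * a * (m * a * g)"
      using M(1) X(2) unfolding g_def by (metis mult.assoc)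
    \<comment> \<open>Contracting \<open>a * g * a\<close> leaves \<open>m * (a * x)\<close>, which
      is \<open>m * (a * m)\<close>.\<close>
    moreover have "m = m * a * g * a * x"
      using M(2) G am by (metis mult.assoc)
    moreover have "x = g * a * m"
      using gp am by (metis mult.assoc)
    ultimately show ?thesis
      using d unfolding mp_inverse_eqI[OF m] dual_core_inverse_eqI[OF d] dual_core_invertible_def
      by blast
  qed
  have "x\<^sup>2 * a = g"
    unfolding g_def by (simp add: power2_eq_square)
  moreover have "group_invertible a" "core_invertible (a ^ n)" "core_invertible x"
    "core_invertible (a * a * x)"
    using g pw y z unfolding group_invertible_def core_invertible_def by blast+
  ultimately show ?thesis
    unfolding eqs using p
    by (intro conjI exI) (rule refl gp[symmetric] impI[OF mp] | assumption)+
qed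

end
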